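(* Let $q$ be a prime power, let $n\ge 1$ and $\Lambda\geq 1$ be integers, and let $\tau>0$. Let $X$ and $Y$ be subsets of $\mathbb{F}_q^n$. Suppose that for every point $x\in X$ there is a curve $C_x$ of degree at most $\Lambda$ in $\mathbb{F}_q^n$ through $x$ (i.e. $x\in C_x$) which intersects $Y$ in at least $\tau$ points. Then $$ |X| \leq \left(1+\frac{\Lambda(q-1)}{\tau}\right)^n |Y|. $$
   Context: $\mathbb{F}_q$ is the finite field with $q$ elements. A curve of degree at most $\Lambda$ in $\mathbb{F}_q^n$ is a set of points of the form $\{(C_1(\lambda),\dots,C_n(\lambda)) : \lambda\in\mathbb{F}_q\}$, where $C_1,\dots,C_n\in\mathbb{F}_q[x]$ are one-variable polynomials of degree at most $\Lambda$. *)

theory Defs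
  imports "HOL-Analysis.Finite_Cartesian_Product" "HOL-Computational_Algebra.Polynomial"
begin

text \<open>
  \<open>\<bbbF>\<^sub>q\<close> is a type \<open>'a\<close> of class \<open>{field, finite}\<close>, with \<open>q = CARD('a)\<close>, and
  \<open>\<bbbF>\<^sub>q\<^sup>n\<close> is \<open>'a ^ 'n\<close>, with \<open>n = CARD('n)\<close>. A curve is the set of its \<open>\<bbbF>\<^sub>q\<close>-points,
  so it does not remember its parametrization.
\<close>

definition curve_of_degree_le :: "nat \<Rightarrow> ('a::{field, finite} ^ 'n) set \<Rightarrow> bool" where
  "curve_of_degree_le \<Lambda> S \<longleftrightarrow>
     (\<exists>C :: 'n \<Rightarrow> 'a poly. (\<forall>i. degree (C i) \<le> \<Lambda>) \<and>
        S = {(\<chi> i. poly (C i) t) | t. t \<in> UNIV})"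

end

theory Submission
  imports Defs
begin

text \<open>
  The method of multiplicities. If a polynomial \<open>P\<close> of degree at most \<open>D\<close> vanishes to order \<open>m\<close>
  on \<open>Y\<close>, then its Hasse derivative of order \<open>k < m\<close> vanishes to order \<open>m - k\<close> on \<open>Y\<close>; restricted
  to \<open>C\<^sub>x\<close> it has degree at most \<open>\<Lambda> (D - k)\<close> and at least \<open>\<tau> (m - k)\<close> roots, so it is
  zero at \<open>x\<close> once \<open>\<Lambda> (D - k) < \<tau> (m - k)\<close>. If this holds for all \<open>k < l\<close>, then \<open>P\<close> vanishes to
  order \<open>l\<close> on \<open>X\<close>. On the other hand, for \<open>D = (l - 1) q + n (q - 1)\<close> there is a family of
  polynomials of degree at most \<open>D\<close>, with one parameter in \<open>\<bbbF>\<^sub>q\<close> for each \<open>x \<in> X\<close> and each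
  multi-index of weight below \<open>l\<close>, of which only the zero polynomial vanishes to order \<open>l\<close> on \<open>X\<close>.
  Counting the jets on \<open>Y\<close> gives
  \<open>|X| \<cdot> (l + n - 1 choose n) \<le> |Y| \<cdot> (m + n - 1 choose n)\<close>, and
  \<open>m / l\<close> may tend to \<open>1 + \<Lambda> (q - 1) / \<tau>\<close>.
  This needs \<open>\<tau> \<ge> \<Lambda>\<close>; otherwise the bound is at least \<open>q\<^sup>n |Y|\<close> and hence trivial.
\<close>

section \<open>Hasse derivatives and Taylor expansion in one variable\<close>

lemma smult_sum_right: "smult a (sum f A) = (\<Sum>x\<in>A. smult a (f x))"
  by (induction A rule: infinite_finite_induct) (simp_all add: smult_add_right)

text \<open>\<open>k!\<close> times this is the usual derivative of order \<open>k\<close>. Without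
  the factorial it still detects orders of vanishing in positive characteristic.\<close>

definition hasse :: "nat \<Rightarrow> 'a::comm_semiring_1 poly \<Rightarrow> 'a poly" where
  "hasse k p = Abs_poly (\<lambda>n. of_nat ((n + k) choose k) * coeff p (n + k))"

lemma coeff_hasse: "coeff (hasse k p) n = of_nat ((n + k) choose k) * coeff p (n + k)"
  unfolding hasse_def by (subst coeff_Abs_poly[of "degree p"]) (auto simp: coeff_eq_0)

lemma hasse_0_left [simp]: "hasse 0 p = p"
  by (rule poly_eqI) (simp add: coeff_hasse)

lemma hasse_0_right [simp]: "hasse k 0 = 0"
  by (rule poly_eqI) (simp add: coeff_hasse)

text \<open>Pascal's rule, i.e. the Leibniz rule for a product with the variable.\<close>

lemma hasse_Suc_pCons: "hasse (Suc k) (pCons a p) = pCons 0 (hasse (Suc k) p) + hasse k p"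
proof (rule poly_eqI)
  fix n
  show "coeff (hasse (Suc k) (pCons a p)) n = coeff (pCons 0 (hasse (Suc k) p) + hasse k p) n"
    by (cases n) (simp_all add: coeff_hasse algebra_simps)
qed

lemma hasse_hasse: "hasse j (hasse k p) = smult (of_nat ((j + k) choose k)) (hasse (j + k) p)"
proof (rule poly_eqI)
  fix n
  have "((n + j) choose j) * ((n + j + k) choose k) = ((j + k) choose k) * ((n + (j + k)) choose (j + k))"
    using choose_mult_lemma[of j n k] by (simp add: ac_simps)
  then have "of_nat ((n + j) choose j) * of_nat ((n + j + k) choose k) =
      (of_nat ((j + k) choose k) * of_nat ((n + (j + k)) choose (j + k)) :: 'a)"
    by (metis of_nat_mult)
  then show "coeff (hasse j (hasse k p)) n = coeff (smult (of_nat ((j + k) choose k)) (hasse (j + k) p)) n"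
    by (simp add: coeff_hasse mult.assoc [symmetric] add.assoc)
qed

lemma hasse_eq_0: "degree p < k \<Longrightarrow> hasse k p = 0"
  by (rule poly_eqI) (simp add: coeff_hasse coeff_eq_0)

lemma degree_hasse_le: "degree (hasse k p) \<le> degree p - k"
  by (rule degree_le) (auto simp: coeff_hasse coeff_eq_0)

text \<open>Induction along \<open>pCons a p\<close>, whose composite is \<open>a\<close> plus
  \<open>C\<close> times that of \<open>p\<close>, with \<open>C = u + [:y:]\<close>. Any
  \<open>N\<close> from the degree on is allowed, so that several factors can share one range of
  summation.\<close>

lemma pcompose_taylor:
  fixes p C :: "'a::comm_ring_1 poly"
  assumes "degree p \<le> N"
  shows "p \<circ>\<^sub>p C = (\<Sum>k\<le>N. smult (poly (hasse k p) y) ((C - [:y:]) ^ k))"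
  using assms
proof (induction p arbitrary: N)
  case 0
  then show ?case by simp
next
  case (pCons a p)
  show ?case
  proof (cases "p = 0")
    case True
    have "(\<Sum>k\<le>N. smult (poly (hasse k [:a:]) y) ((C - [:y:]) ^ k)) =
        (\<Sum>k\<in>{0}. smult (poly (hasse k [:a:]) y) ((C - [:y:]) ^ k))"
      by (rule sum.mono_neutral_right) (auto simp: hasse_eq_0)
    with True show ?thesis by simp
  next
    case False
    with pCons.prems obtain M where M: "N = Suc M" "degree p \<le> M"
      by (cases N) auto
    define u where "u = C - [:y:]"
    define h where "h k = poly (hasse k p) y" for k
    have C: "C = u + [:y:]" by (simp add: u_def)
    \<comment> \<open>The expansion up to \<open>M\<close> will be multiplied by \<open>u\<close>,
      the one up to \<open>Suc M\<close> by \<open>y\<close>; the shifted form lets them be added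
      term by term.\<close>
    have IH: "p \<circ>\<^sub>p C = (\<Sum>k\<le>M. smult (h k) (u ^ k))"
      "p \<circ>\<^sub>p C = smult (h 0) (u ^ 0) + (\<Sum>k\<le>M. smult (h (Suc k)) (u ^ Suc k))"
      using pCons.IH[of M] pCons.IH[of "Suc M"] M unfolding sum.atMost_Suc_shift
      by (auto simp: u_def h_def)
    have "(\<Sum>k\<le>N. smult (poly (hasse k (pCons a p)) y) (u ^ k)) =
        [:a + y * h 0:] + (\<Sum>k\<le>M. smult (y * h (Suc k) + h k) (u ^ Suc k))"
      unfolding M(1) sum.atMost_Suc_shift by (simp add: hasse_Suc_pCons h_def)
    also have "\<dots> = [:a:] + smult y (smult (h 0) (u ^ 0) + (\<Sum>k\<le>M. smult (h (Suc k)) (u ^ Suc k)))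
        + u * (\<Sum>k\<le>M. smult (h k) (u ^ k))"
      by (simp add: smult_add_right smult_add_left sum.distrib sum_distrib_left smult_sum_right add_ac)
    also have "\<dots> = [:a:] + smult y (p \<circ>\<^sub>p C) + u * (p \<circ>\<^sub>p C)"
      by (simp only: IH(1)[symmetric] IH(2)[symmetric])
    also have "\<dots> = pCons a p \<circ>\<^sub>p C"
      by (simp add: pcompose_pCons C algebra_simps)
    finally show ?thesis by (simp add: u_def)
  qed
qed

text \<open>Taylor expansion with \<open>C - [:y:]\<close> equal to the variable itself.\<close>

lemma poly_hasse_eq_coeff: "poly (hasse k p) y = coeff (p \<circ>\<^sub>p [:y, 1:]) k"
  for p :: "'a::comm_ring_1 poly"
proof -
  have "p \<circ>\<^sub>p [:y, 1:] = (\<Sum>j\<le>max k (degree p). monom (poly (hasse j p) y) j)"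
    using pcompose_taylor[of p "max k (degree p)" "[:y, 1:]" y]
    by (simp add: monom_altdef)
  then show ?thesis by (simp add: coeff_sum)
qed

text \<open>The shift by \<open>y\<close> turns \<open>[:- y, 1:] ^ r\<close> into
  \<open>monom 1 r\<close>, so the expansion at \<open>y\<close> has no terms below order
  \<open>r\<close> and \<open>poly h y\<close> in order \<open>r\<close>.\<close>

lemma poly_hasse_linear_power_mult:
  fixes h :: "'a::comm_ring_1 poly"
  assumes "k \<le> r"
  shows "poly (hasse k ([:- y, 1:] ^ r * h)) y = (if k = r then poly h y else 0)"
proof -
  have "([:- y, 1:] ^ r) \<circ>\<^sub>p [:y, 1:] = monom 1 r"
    by (induction r) (simp_all add: pcompose_1 pcompose_diff pcompose_smult pcompose_pCons monom_Suc)
  then have "([:- y, 1:] ^ r * h) \<circ>\<^sub>p [:y, 1:] = monom 1 r * (h \<circ>\<^sub>p [:y, 1:])"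
    by (simp add: pcompose_mult)
  with assms show ?thesis
    by (auto simp: poly_hasse_eq_coeff coeff_monom_mult)
qed

section \<open>Several variables: derivatives and restriction to a curve\<close>

text \<open>The multivariate polynomial \<open>\<Sum>\<^sub>j c\<^sub>j \<Prod>\<^sub>i p\<^sub>j\<^sub>i(x\<^sub>i)\<close> is represented by the family \<open>J, c, p\<close>.
  The derivative with multi-index \<open>\<alpha>\<close> acts on each univariate factor separately.\<close>

definition hasse_at ::
    "'j set \<Rightarrow> ('j \<Rightarrow> 'a::comm_ring_1) \<Rightarrow> ('j \<Rightarrow> 'n \<Rightarrow> 'a poly) \<Rightarrow> ('n \<Rightarrow> nat) \<Rightarrow> 'a ^ 'n \<Rightarrow> 'a" where
  "hasse_at J c p \<alpha> x = (\<Sum>j\<in>J. c j * (\<Prod>i\<in>UNIV. poly (hasse (\<alpha> i) (p j i)) (x $ i)))"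

definition hasse_along ::
    "'j set \<Rightarrow> ('j \<Rightarrow> 'a::comm_ring_1) \<Rightarrow> ('j \<Rightarrow> 'n::finite \<Rightarrow> 'a poly) \<Rightarrow> ('n \<Rightarrow> nat) \<Rightarrow> ('n \<Rightarrow> 'a poly) \<Rightarrow> 'a poly" where
  "hasse_along J c p \<alpha> C = (\<Sum>j\<in>J. smult (c j) (\<Prod>i\<in>UNIV. hasse (\<alpha> i) (p j i) \<circ>\<^sub>p C i))"

lemma poly_hasse_along: "poly (hasse_along J c p \<alpha> C) t = hasse_at J c p \<alpha> (\<chi> i. poly (C i) t)"
  by (simp add: hasse_along_def hasse_at_def poly_sum poly_prod poly_pcompose)

lemma degree_hasse_along_le:
  fixes p :: "'j \<Rightarrow> 'n::finite \<Rightarrow> 'a::comm_ring_1 poly"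
  assumes J: "finite J" and D: "\<And>j. j \<in> J \<Longrightarrow> (\<Sum>i\<in>UNIV. degree (p j i)) \<le> D"
    and C: "\<And>i. degree (C i) \<le> \<Lambda>"
  shows "degree (hasse_along J c p \<alpha> C) \<le> \<Lambda> * (D - sum \<alpha> UNIV)"
  unfolding hasse_along_def
proof (rule degree_sum_le[OF J])
  fix j assume j: "j \<in> J"
  let ?f = "\<lambda>i. hasse (\<alpha> i) (p j i) \<circ>\<^sub>p C i"
  have "degree (prod ?f UNIV) \<le> \<Lambda> * (D - sum \<alpha> UNIV)"
  \<comment> \<open>Truncated subtraction commutes with the sum over \<open>i\<close> if no
    \<open>\<alpha> i\<close> exceeds the degree; otherwise some factor is zero.\<close>
  proof (cases "\<exists>i. degree (p j i) < \<alpha> i")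
    case True
    then have "prod ?f UNIV = 0"
      by (metis (mono_tags, lifting) hasse_eq_0 pcompose_0 prod_zero finite UNIV_I)
    then show ?thesis by simp
  next
    case False
    have "degree (prod ?f UNIV) \<le> (\<Sum>i\<in>UNIV. degree (?f i))"
      using degree_prod_sum_le[of UNIV ?f] by (simp add: o_def)
    also have "\<dots> \<le> (\<Sum>i\<in>UNIV. (degree (p j i) - \<alpha> i) * \<Lambda>)"
      by (intro sum_mono order_trans[OF degree_pcompose_le] mult_mono degree_hasse_le C) auto
    also have "\<dots> = \<Lambda> * (\<Sum>i\<in>UNIV. degree (p j i) - \<alpha> i)"
      by (simp add: sum_distrib_left mult.commute)
    also have "(\<Sum>i\<in>UNIV. degree (p j i) - \<alpha> i) = (\<Sum>i\<in>UNIV. degree (p j i)) - sum \<alpha> UNIV"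
      using False by (intro sum_subtractf_nat) (auto simp: not_less)
    also have "\<Lambda> * \<dots> \<le> \<Lambda> * (D - sum \<alpha> UNIV)"
      using D[OF j] by (intro mult_left_mono) auto
    finally show ?thesis .
  qed
  then show "degree (smult (c j) (prod ?f UNIV)) \<le> \<Lambda> * (D - sum \<alpha> UNIV)"
    using degree_smult_le order_trans by blast
qed

text \<open>Expand at the point \<open>y\<close> with parameter \<open>t\<close>. The term of index
  \<open>\<beta>\<close> is divisible by \<open>[:- t, 1:] ^ sum \<beta> UNIV\<close>, and its
  coefficient is a multiple of the derivative of index \<open>\<beta> + \<alpha>\<close> at
  \<open>y\<close>. Either this index has weight below \<open>m\<close> and the coefficient is zero,
  or the power is high enough.\<close>

lemma linear_power_dvd_hasse_along:
  fixes p :: "'j \<Rightarrow> 'n::finite \<Rightarrow> 'a::idom poly"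
  assumes J: "finite J"
    and van: "\<And>\<beta>. sum \<beta> UNIV < m \<Longrightarrow> hasse_at J c p \<beta> (\<chi> i. poly (C i) t) = 0"
  shows "[:- t, 1:] ^ (m - sum \<alpha> UNIV) dvd hasse_along J c p \<alpha> C"
proof -
  define y :: "'a ^ 'n" where "y = (\<chi> i. poly (C i) t)"
  \<comment> \<open>A crude common bound for the degrees, so that one index set \<open>B\<close>
    serves all \<open>j\<close>.\<close>
  define N where "N = (\<Sum>j\<in>J. \<Sum>i\<in>UNIV. degree (hasse (\<alpha> i) (p j i)))"
  define B where "B = PiE (UNIV :: 'n set) (\<lambda>_. {..N})"
  define b where "b \<beta> = (\<Prod>i\<in>UNIV. of_nat ((\<beta> i + \<alpha> i) choose \<alpha> i) :: 'a)" for \<beta> :: "'n \<Rightarrow> nat"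
  define u where "u \<beta> = (\<Prod>i\<in>UNIV. (C i - [:y $ i:]) ^ \<beta> i)" for \<beta> :: "'n \<Rightarrow> nat"
  have N: "degree (hasse (\<alpha> i) (p j i)) \<le> N" if "j \<in> J" for j i
  proof -
    have "degree (hasse (\<alpha> i) (p j i)) \<le> (\<Sum>i\<in>UNIV. degree (hasse (\<alpha> i) (p j i)))"
      by (rule member_le_sum) auto
    also have "\<dots> \<le> N"
      unfolding N_def using that J by (intro member_le_sum) auto
    finally show ?thesis .
  qed
  have "(\<Prod>i\<in>UNIV. hasse (\<alpha> i) (p j i) \<circ>\<^sub>p C i) =
      (\<Sum>\<beta>\<in>B. smult (b \<beta> * (\<Prod>i\<in>UNIV. poly (hasse (\<beta> i + \<alpha> i) (p j i)) (y $ i))) (u \<beta>))"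
    if "j \<in> J" for j
  proof -
    have "(\<Prod>i\<in>UNIV. hasse (\<alpha> i) (p j i) \<circ>\<^sub>p C i) =
        (\<Prod>i\<in>UNIV. \<Sum>k\<le>N. smult (poly (hasse k (hasse (\<alpha> i) (p j i))) (y $ i)) ((C i - [:y $ i:]) ^ k))"
      using that by (intro prod.cong refl pcompose_taylor N)
    also have "\<dots> = (\<Sum>\<beta>\<in>B. \<Prod>i\<in>UNIV.
        smult (poly (hasse (\<beta> i) (hasse (\<alpha> i) (p j i))) (y $ i)) ((C i - [:y $ i:]) ^ \<beta> i))"
      unfolding B_def by (rule prod_sum_PiE) auto
    finally show ?thesis
      by (simp add: hasse_hasse prod_smult prod.distrib b_def u_def)
  qed
  then have "hasse_along J c p \<alpha> C =
      (\<Sum>j\<in>J. \<Sum>\<beta>\<in>B. smult (b \<beta> * (c j * (\<Prod>i\<in>UNIV. poly (hasse (\<beta> i + \<alpha> i) (p j i)) (y $ i)))) (u \<beta>))"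
    unfolding hasse_along_def by (intro sum.cong) (auto simp: smult_sum_right mult_ac)
  also have "\<dots> = (\<Sum>\<beta>\<in>B. smult (b \<beta> * hasse_at J c p (\<lambda>i. \<beta> i + \<alpha> i) y) (u \<beta>))"
    by (subst sum.swap) (simp add: hasse_at_def smult_sum sum_distrib_left)
  also have "[:- t, 1:] ^ (m - sum \<alpha> UNIV) dvd \<dots>"
  proof (rule dvd_sum)
    fix \<beta>
    show "[:- t, 1:] ^ (m - sum \<alpha> UNIV) dvd smult (b \<beta> * hasse_at J c p (\<lambda>i. \<beta> i + \<alpha> i) y) (u \<beta>)"
    proof (cases "sum \<beta> UNIV + sum \<alpha> UNIV < m")
      case True
      then show ?thesis using van[of "\<lambda>i. \<beta> i + \<alpha> i"] by (simp add: sum.distrib y_def)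
    next
      case False
      have "[:- t, 1:] dvd C i - [:y $ i:]" for i
        by (simp add: poly_eq_0_iff_dvd[symmetric] y_def)
      then have "(\<Prod>i\<in>UNIV. [:- t, 1:] ^ \<beta> i) dvd u \<beta>"
        unfolding u_def by (intro prod_dvd_prod dvd_power_same)
      then have "[:- t, 1:] ^ (sum \<beta> UNIV) dvd u \<beta>"
        by (simp add: power_sum)
      moreover have "[:- t, 1:] ^ (m - sum \<alpha> UNIV) dvd [:- t, 1:] ^ (sum \<beta> UNIV)"
        using False by (intro le_imp_power_dvd) simp
      ultimately show ?thesis
        by (meson dvd_smult dvd_trans)
    qed
  qed
  finally show ?thesis .
qed

lemma degree_ge_card_times_multiplicity:
  fixes R :: "'a::idom poly"
  assumes "R \<noteq> 0" and "0 < k" and T: "\<And>t. t \<in> T \<Longrightarrow> [:- t, 1:] ^ k dvd R"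
  shows "k * card T \<le> degree R"
proof -
  have fin: "finite {t. poly R t = 0}"
    using assms(1) by (rule poly_roots_finite)
  have ord: "k \<le> order t R" if "t \<in> T" for t
    using T[OF that] assms(1) by (simp add: order_divides)
  have sub: "T \<subseteq> {t. poly R t = 0}"
    using ord assms(2) by (fastforce simp: order_root)
  have "k * card T = (\<Sum>t\<in>T. k)"
    by simp
  also have "\<dots> \<le> (\<Sum>t\<in>T. order t R)"
    using ord by (rule sum_mono)
  also have "\<dots> \<le> (\<Sum>t | poly R t = 0. order t R)"
    using fin sub by (intro sum_mono2) auto
  also have "\<dots> \<le> degree R"
    using assms(1) by (rule sum_order_le_degree)
  finally show ?thesis .
qed

section \<open>Interpolation polynomials for jets\<close>

text \<open>\<open>jet_basis b r\<close> vanishes to order exactly \<open>r\<close> at \<open>b\<close> and to order \<open>r + 1\<close> elsewhere. Hence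
  the jets of the products of these polynomials are triangular with respect to the order.\<close>

definition jet_basis :: "'a::{field, finite} \<Rightarrow> nat \<Rightarrow> 'a poly" where
  "jet_basis b r = (\<Prod>c\<in>UNIV. [:- c, 1:]) ^ r * (\<Prod>c\<in>UNIV - {b}. [:- c, 1:])"

lemma degree_jet_basis:
  "degree (jet_basis b r :: 'a::{field, finite} poly) = r * CARD('a) + (CARD('a) - 1)"
proof -
  have "degree (\<Prod>c\<in>A. [:- c, 1:] :: 'a poly) = card A" for A
    by (subst degree_prod_sum_eq) auto
  then show ?thesis
    unfolding jet_basis_def by (subst degree_mult_eq) (auto simp: degree_power_eq card_Diff_singleton)
qed

text \<open>Once \<open>[:- a, 1:] ^ r\<close> is split off, the cofactor \<open>h\<close> still
  contains \<open>[:- a, 1:]\<close> unless \<open>a\<close> is the omitted point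
  \<open>b\<close>.\<close>

lemma poly_hasse_jet_basis:
  assumes "k \<le> r"
  shows "poly (hasse k (jet_basis b r)) a \<noteq> 0 \<longleftrightarrow> k = r \<and> a = b"
proof -
  define h where "h = (\<Prod>c\<in>UNIV - {a}. [:- c, 1:]) ^ r * (\<Prod>c\<in>UNIV - {b}. [:- c, 1:])"
  have "(\<Prod>c\<in>UNIV. [:- c, 1:]) = [:- a, 1:] * (\<Prod>c\<in>UNIV - {a}. [:- c, 1:])"
    by (rule prod.remove) auto
  then have "jet_basis b r = [:- a, 1:] ^ r * h"
    by (simp only: jet_basis_def h_def power_mult_distrib mult.assoc)
  moreover have "poly h a \<noteq> 0 \<longleftrightarrow> a = b"
    by (auto simp: h_def poly_prod)
  ultimately show ?thesis
    using poly_hasse_linear_power_mult[OF assms, of a h] by auto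
qed

section \<open>Counting multi-indices\<close>

definition exponents_less :: "nat \<Rightarrow> ('n::finite \<Rightarrow> nat) set" where
  "exponents_less l = {\<alpha>. sum \<alpha> UNIV < l}"

lemma finite_exponents_less: "finite (exponents_less l :: ('n::finite \<Rightarrow> nat) set)"
proof (rule finite_subset)
  have "\<alpha> i < l" if "sum \<alpha> UNIV < l" for \<alpha> :: "'n \<Rightarrow> nat" and i
    using member_le_sum[of i UNIV \<alpha>] that by simp
  then show "exponents_less l \<subseteq> PiE (UNIV :: 'n set) (\<lambda>_. {..<l})"
    by (auto simp: exponents_less_def)
qed (auto intro: finite_PiE)

text \<open>Stars and bars: the slack \<open>L - sum \<alpha> UNIV\<close> becomes an additional
  entry, which leads to lists of length \<open>CARD('n) + 1\<close> with sum \<open>L\<close>. The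
  bijection \<open>h\<close> puts the index type in order.\<close>

lemma card_exponents_less:
  "card (exponents_less (Suc L) :: ('n::finite \<Rightarrow> nat) set) = (L + CARD('n)) choose CARD('n)"
proof -
  obtain h where h: "bij_betw h {0..<CARD('n)} (UNIV :: 'n set)"
    using ex_bij_betw_nat_finite[of "UNIV :: 'n set"] by auto
  define g where "g = inv_into {0..<CARD('n)} h"
  have g: "g i < CARD('n)" "h (g i) = i" for i
    using h bij_betw_inv_into_right[OF h, of i] bij_betw_apply[OF bij_betw_inv_into[OF h], of i]
    by (auto simp: g_def)
  have gh: "g (h k) = k" if "k < CARD('n)" for k
    using bij_betw_inv_into_left[OF h, of k] that by (simp add: g_def)
  define F where "F \<alpha> = (L - sum \<alpha> UNIV) # map (\<lambda>k. \<alpha> (h k)) [0..<CARD('n)]" for \<alpha> :: "'n \<Rightarrow> nat"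
  have s: "sum_list (map (\<lambda>k. \<alpha> (h k)) [0..<CARD('n)]) = sum \<alpha> UNIV" for \<alpha> :: "'n \<Rightarrow> nat"
    using sum.reindex_bij_betw[OF h, of \<alpha>] by (simp add: sum_list_distinct_conv_sum_set)
  have "bij_betw F (exponents_less (Suc L)) {xs. size xs = Suc (CARD('n)) \<and> sum_list xs = L}"
  proof (rule bij_betwI[where g = "\<lambda>xs i. xs ! Suc (g i)"])
    show "F \<in> exponents_less (Suc L) \<rightarrow> {xs. size xs = Suc (CARD('n)) \<and> sum_list xs = L}"
      by (auto simp: F_def exponents_less_def s)
  next
    show "(\<lambda>xs i. xs ! Suc (g i)) \<in> {xs. size xs = Suc (CARD('n)) \<and> sum_list xs = L} \<rightarrow> exponents_less (Suc L)"
    proof safe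
      fix xs :: "nat list"
      assume xs: "size xs = Suc (CARD('n))" "L = sum_list xs"
      then obtain x ys where x: "xs = x # ys" "size ys = CARD('n)" by (cases xs) auto
      have "(\<Sum>i\<in>UNIV. ys ! g i) = (\<Sum>k\<in>{0..<CARD('n)}. ys ! g (h k))"
        by (rule sum.reindex_bij_betw[OF h, symmetric])
      also have "\<dots> = (\<Sum>k\<in>{0..<CARD('n)}. ys ! k)"
        by (rule sum.cong) (auto simp: gh)
      also have "\<dots> = sum_list ys" using x by (simp add: sum_list_sum_nth)
      finally show "(\<lambda>i. xs ! Suc (g i)) \<in> exponents_less (Suc (sum_list xs))"
        using x by (simp add: exponents_less_def)
    qed
  next
    fix \<alpha> :: "'n \<Rightarrow> nat"
    show "(\<lambda>i. F \<alpha> ! Suc (g i)) = \<alpha>"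
      by (auto simp: F_def g)
  next
    fix xs :: "nat list"
    assume "xs \<in> {xs. size xs = Suc (CARD('n)) \<and> sum_list xs = L}"
    then have xs: "size xs = Suc (CARD('n))" "sum_list xs = L" by auto
    then obtain x ys where x: "xs = x # ys" "size ys = CARD('n)" by (cases xs) auto
    have m: "map (\<lambda>k. xs ! Suc (g (h k))) [0..<CARD('n)] = ys"
      using x by (intro nth_equalityI) (auto simp: gh)
    then have "(\<Sum>i\<in>UNIV. xs ! Suc (g i)) = sum_list ys"
      using s[of "\<lambda>i. xs ! Suc (g i)"] by simp
    then show "F (\<lambda>i. xs ! Suc (g i)) = xs"
      unfolding F_def m using xs x by simp
  qed
  then have "card (exponents_less (Suc L) :: ('n \<Rightarrow> nat) set) =
      card {xs :: nat list. size xs = Suc (CARD('n)) \<and> sum_list xs = L}"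
    by (rule bij_betw_same_card)
  also have "\<dots> = (L + CARD('n)) choose L"
    by (subst card_length_sum_list) simp
  finally show ?thesis
    using binomial_symmetric[of L "L + CARD('n)"] by simp
qed

text \<open>The right-hand side is the product of \<open>L + 1, ..., L + n\<close>.\<close>

lemma power_le_fact_mult_binomial: "Suc L ^ n \<le> fact n * ((L + n) choose n)"
proof (induction n)
  case (Suc n)
  have "Suc L ^ Suc n \<le> Suc (L + n) * (fact n * ((L + n) choose n))"
    unfolding power_Suc using Suc by (intro mult_mono) auto
  also have "\<dots> = fact n * (Suc (L + n) * ((L + n) choose n))"
    by (simp only: mult_ac)
  also have "Suc (L + n) * ((L + n) choose n) = Suc n * (Suc (L + n) choose Suc n)"
    by (metis Suc_times_binomial_eq mult.commute)
  finally show ?case by (simp add: algebra_simps del: binomial_Suc_Suc)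
qed simp

section \<open>Injectivity of jets and comparison of dimensions\<close>

text \<open>Among the nonzero coefficients take one whose multi-index has least weight. By
  triangularity, the derivative with its own index at its own point sees no other term.\<close>

lemma hasse_at_jet_basis_nonzero:
  fixes X :: "('a::{field, finite} ^ 'n) set" and c :: "('a ^ 'n) \<times> ('n \<Rightarrow> nat) \<Rightarrow> 'a"
  assumes "j0 \<in> X \<times> exponents_less l" and "c j0 \<noteq> 0"
  shows "\<exists>x\<in>X. \<exists>\<alpha>\<in>exponents_less l.
    hasse_at (X \<times> exponents_less l) c (\<lambda>(a, r) i. jet_basis (a $ i) (r i)) \<alpha> x \<noteq> 0"
proof -
  let ?J = "X \<times> (exponents_less l :: ('n \<Rightarrow> nat) set)"
  have fin: "finite ?J" by (simp add: finite_exponents_less)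
  define x \<alpha> where "x = fst (arg_min (\<lambda>(a, r). sum r UNIV) (\<lambda>j. j \<in> ?J \<and> c j \<noteq> 0))"
    and "\<alpha> = snd (arg_min (\<lambda>(a, r). sum r UNIV) (\<lambda>j. j \<in> ?J \<and> c j \<noteq> 0))"
  have nz: "(x, \<alpha>) \<in> ?J" "c (x, \<alpha>) \<noteq> 0"
    using arg_min_natI[of "\<lambda>j. j \<in> ?J \<and> c j \<noteq> 0" j0 "\<lambda>(a, r). sum r UNIV"] assms
    by (simp_all add: x_def \<alpha>_def)
  have min: "sum \<alpha> UNIV \<le> sum r UNIV" if "(a, r) \<in> ?J" "c (a, r) \<noteq> 0" for a r
    using arg_min_nat_le[of "\<lambda>j. j \<in> ?J \<and> c j \<noteq> 0" "(a, r)" "\<lambda>(a, r). sum r UNIV"] that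
    by (simp add: x_def \<alpha>_def case_prod_beta)
  define t where "t j = c j * (\<Prod>i\<in>UNIV. poly (hasse (\<alpha> i) (jet_basis (fst j $ i) (snd j i))) (x $ i))" for j
  have "t j = 0" if j: "j \<in> ?J - {(x, \<alpha>)}" for j
  proof (cases "c j = 0")
    case False
    obtain a r where ar: "j = (a, r)" by (cases j)
    have le: "sum \<alpha> UNIV \<le> sum r UNIV" using min j False ar by auto
    \<comment> \<open>Otherwise \<open>r\<close> would be at most \<open>\<alpha>\<close> in every
      coordinate; its weight being no smaller, \<open>r = \<alpha>\<close>, and then
      \<open>a = x\<close>.\<close>
    have "\<exists>i. \<alpha> i \<le> r i \<and> \<not> (\<alpha> i = r i \<and> x $ i = a $ i)"
    proof (rule ccontr)
      assume "\<not> ?thesis"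
      then have eq: "\<And>i. \<alpha> i \<le> r i \<Longrightarrow> \<alpha> i = r i \<and> x $ i = a $ i" by blast
      then have "\<And>i. r i \<le> \<alpha> i" by (metis nat_le_linear order_refl)
      then have "\<And>i. r i = \<alpha> i"
        using le sum_strict_mono_ex1[of UNIV r \<alpha>]
        by (metis finite UNIV_I le_neq_implies_less not_less)
      then have "j = (x, \<alpha>)" using eq ar by (auto simp: vec_eq_iff)
      with j show False by simp
    qed
    then obtain i where "\<alpha> i \<le> r i" "\<not> (\<alpha> i = r i \<and> x $ i = a $ i)" by blast
    then have "poly (hasse (\<alpha> i) (jet_basis (a $ i) (r i))) (x $ i) = 0"
      using poly_hasse_jet_basis by blast
    then show ?thesis unfolding t_def ar by (auto intro!: prod_zero)
  qed (simp add: t_def)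
  then have "sum t ?J = t (x, \<alpha>)"
    using fin nz(1) by (subst sum.remove[of _ "(x, \<alpha>)"]) auto
  moreover have "t (x, \<alpha>) \<noteq> 0"
    using nz(2) by (auto simp: t_def poly_hasse_jet_basis)
  moreover have "hasse_at ?J c (\<lambda>(a, r) i. jet_basis (a $ i) (r i)) \<alpha> x = sum t ?J"
    by (simp add: hasse_at_def t_def case_prod_beta)
  ultimately show ?thesis using nz(1) by (intro bexI[of _ x] bexI[of _ \<alpha>]) auto
qed

lemma hasse_at_diff:
  "hasse_at J (\<lambda>j. c j - d j) p \<alpha> x = hasse_at J c p \<alpha> x - hasse_at J d p \<alpha> x"
  by (simp add: hasse_at_def left_diff_distrib sum_subtractf)

text \<open>Taking jets on \<open>Y\<close> is a linear map on coefficient families. Its kernel is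
  trivial, as \<open>vanish\<close> carries zero jets over to \<open>X\<close>, where only the zero
  family has them. Over a finite field, cardinalities can stand in for dimensions.\<close>

lemma card_mult_exponents_le:
  fixes X Y :: "('a::{field, finite} ^ 'n) set"
  assumes vanish: "\<And>c. \<forall>y\<in>Y. \<forall>\<beta>\<in>exponents_less m.
        hasse_at (X \<times> exponents_less l) c (\<lambda>(a, r) i. jet_basis (a $ i) (r i)) \<beta> y = 0 \<Longrightarrow>
      \<forall>x\<in>X. \<forall>\<alpha>\<in>exponents_less l.
        hasse_at (X \<times> exponents_less l) c (\<lambda>(a, r) i. jet_basis (a $ i) (r i)) \<alpha> x = 0"
  shows "card X * card (exponents_less l :: ('n \<Rightarrow> nat) set)
    \<le> card Y * card (exponents_less m :: ('n \<Rightarrow> nat) set)"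
proof -
  let ?J = "X \<times> (exponents_less l :: ('n \<Rightarrow> nat) set)"
  let ?K = "Y \<times> (exponents_less m :: ('n \<Rightarrow> nat) set)"
  let ?h = "\<lambda>c. hasse_at ?J c (\<lambda>(a, r) i. jet_basis (a $ i) (r i))"
  define F where "F c = (\<lambda>k\<in>?K. ?h c (snd k) (fst k))" for c
  have fin: "finite ?J" "finite ?K" by (simp_all add: finite_exponents_less)
  have "inj_on F (PiE ?J (\<lambda>_. UNIV))"
  proof (rule inj_onI)
    fix c d assume cd: "c \<in> PiE ?J (\<lambda>_. UNIV)" "d \<in> PiE ?J (\<lambda>_. UNIV)" and eq: "F c = F d"
    have "?h (\<lambda>j. c j - d j) \<beta> y = 0" if "y \<in> Y" "\<beta> \<in> exponents_less m" for y \<beta>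
      using fun_cong[OF eq, of "(y, \<beta>)"] that by (simp add: F_def hasse_at_diff)
    then have "\<forall>x\<in>X. \<forall>\<alpha>\<in>exponents_less l. ?h (\<lambda>j. c j - d j) \<alpha> x = 0"
      using vanish by blast
    then have "c j - d j = 0" if "j \<in> ?J" for j
      using hasse_at_jet_basis_nonzero[OF that, of "\<lambda>j. c j - d j"] by blast
    then show "c = d" using cd by (intro PiE_ext) auto
  qed
  moreover have "F ` PiE ?J (\<lambda>_. UNIV) \<subseteq> PiE ?K (\<lambda>_. UNIV)"
    by (auto simp: F_def split: if_splits)
  ultimately have "card (PiE ?J (\<lambda>_. UNIV :: 'a set)) \<le> card (PiE ?K (\<lambda>_. UNIV :: 'a set))"
    using fin by (intro card_inj_on_le[of F]) (auto intro: finite_PiE)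
  then have "CARD('a) ^ card ?J \<le> CARD('a) ^ card ?K"
    using fin by (simp add: card_PiE)
  \<comment> \<open>Comparing exponents requires a base greater than 1.\<close>
  moreover have "card {0, 1 :: 'a} \<le> CARD('a)" by (rule card_mono) auto
  ultimately have "card ?J \<le> card ?K" by (auto dest: power_le_imp_le_exp[rotated])
  then show ?thesis by (simp add: card_cartesian_product)
qed

section \<open>Vanishing passes from \<open>Y\<close> to \<open>X\<close> along the curves\<close>

text \<open>The restricted derivative \<open>R\<close> has a zero of multiplicity at least
  \<open>m - sum \<alpha> UNIV\<close> at each parameter in \<open>T\<close>, which is too much for
  its degree unless \<open>R = 0\<close>.\<close>

lemma hasse_at_eq_0_transfer:
  fixes X Y :: "('a::{field, finite} ^ 'n) set" and p :: "'j \<Rightarrow> 'n \<Rightarrow> 'a poly"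
  assumes J: "finite J" and D: "\<And>j. j \<in> J \<Longrightarrow> (\<Sum>i\<in>UNIV. degree (p j i)) \<le> D"
    and van: "\<And>y \<beta>. y \<in> Y \<Longrightarrow> sum \<beta> UNIV < m \<Longrightarrow> hasse_at J c p \<beta> y = 0"
    and S: "curve_of_degree_le \<Lambda> S" "x \<in> S" "\<tau> \<le> real (card (S \<inter> Y))"
    and \<alpha>: "sum \<alpha> UNIV < m"
    and less: "real (\<Lambda> * (D - sum \<alpha> UNIV)) < \<tau> * real (m - sum \<alpha> UNIV)"
  shows "hasse_at J c p \<alpha> x = 0"
proof -
  obtain C :: "'n \<Rightarrow> 'a poly" where C: "\<And>i. degree (C i) \<le> \<Lambda>"
    and S_eq: "S = {(\<chi> i. poly (C i) t) | t. t \<in> UNIV}"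
    using S(1) unfolding curve_of_degree_le_def by blast
  define R where "R = hasse_along J c p \<alpha> C"
  define T where "T = {t. (\<chi> i. poly (C i) t) \<in> Y}"
  \<comment> \<open>Several parameters may give the same point, so this yields only an inequality,
    in the direction required.\<close>
  have "S \<inter> Y \<subseteq> (\<lambda>t. \<chi> i. poly (C i) t) ` T"
    by (auto simp: S_eq T_def)
  then have "card (S \<inter> Y) \<le> card T"
    by (meson surj_card_le finite)
  have "R = 0"
  proof (rule ccontr)
    assume "R \<noteq> 0"
    then have "(m - sum \<alpha> UNIV) * card T \<le> degree R"
      using \<alpha> van unfolding R_def T_def
      by (intro degree_ge_card_times_multiplicity linear_power_dvd_hasse_along J) auto
    also have "\<dots> \<le> \<Lambda> * (D - sum \<alpha> UNIV)"
      unfolding R_def by (intro degree_hasse_along_le J D C)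
    finally have "real ((m - sum \<alpha> UNIV) * card T) < \<tau> * real (m - sum \<alpha> UNIV)"
      using less by linarith
    moreover have "\<tau> * real (m - sum \<alpha> UNIV) \<le> real (card T) * real (m - sum \<alpha> UNIV)"
      using S(3) \<open>card (S \<inter> Y) \<le> card T\<close> by (intro mult_right_mono) auto
    ultimately show False by (simp add: mult.commute)
  qed
  moreover obtain t where "x = (\<chi> i. poly (C i) t)" using S(2) S_eq by blast
  ultimately show ?thesis
    using poly_hasse_along[of J c p \<alpha> C t] by (simp add: R_def)
qed

section \<open>Choice of the orders and passage to the limit\<close>

theorem theorem6p6:
  fixes X Y :: "('a::{field, finite} ^ 'n) set"
    and \<Lambda> :: nat and \<tau> :: real
  assumes "\<Lambda> \<ge> 1" and "\<tau> > 0"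
    and "\<And>x. x \<in> X \<Longrightarrow>
           \<exists>C. curve_of_degree_le \<Lambda> C \<and> x \<in> C \<and> real (card (C \<inter> Y)) \<ge> \<tau>"
  shows "real (card X) \<le>
           (1 + real \<Lambda> * (real CARD('a) - 1) / \<tau>) ^ CARD('n) * real (card Y)"
proof -
  define q where "q = CARD('a)"
  define n where "n = CARD('n)"
  define \<rho> where "\<rho> = 1 + real \<Lambda> * (real q - 1) / \<tau>"
  have q: "q \<ge> 1" unfolding q_def by (simp add: Suc_leI)
  have \<rho>: "\<rho> \<ge> 1" using q assms(2) by (simp add: \<rho>_def)
  have "real (card X) \<le> \<rho> ^ n * real (card Y)"
  proof (cases "\<tau> < real \<Lambda>")
    case True
    show ?thesis
    proof (cases "X = {}")
      \<comment> \<open>The trivial bound \<open>q ^ n\<close> suffices: \<open>Y\<close> is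
        nonempty and \<open>q \<le> \<rho>\<close>.\<close>
      case False
      then obtain x C where "x \<in> X" "real (card (C \<inter> Y)) \<ge> \<tau>" using assms(3) by blast
      then have "card (C \<inter> Y) \<noteq> 0" using assms(2) by auto
      then have "1 \<le> real (card Y)" by (auto simp: card_eq_0_iff Suc_le_eq card_gt_0_iff)
      moreover have "card X \<le> CARD('a ^ 'n)" by (rule card_mono) auto
      then have "real (card X) \<le> real q ^ n" by (simp add: q_def n_def flip: of_nat_power)
      moreover have "\<tau> * (real q - 1) \<le> real \<Lambda> * (real q - 1)"
        using True q by (intro mult_right_mono) auto
      then have "real q \<le> \<rho>" using assms(2) by (simp add: \<rho>_def field_simps)
      then have "real q ^ n * 1 \<le> \<rho> ^ n * real (card Y)"
        using \<open>1 \<le> real (card Y)\<close> \<rho> by (intro mult_mono power_mono) auto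
      ultimately show ?thesis by linarith
    qed (use \<rho> in auto)
  next
    case False
    have main: "real (card X) * real (Suc L) ^ n \<le> real (card Y) * (\<rho> * (real L + 2 * real n)) ^ n" for L
    proof -
      \<comment> \<open>The orders are \<open>Suc L\<close> on \<open>X\<close> and
        \<open>Suc M\<close> on \<open>Y\<close>. As \<open>D - L = (L + n) * (q - 1)\<close>, the
        degree condition for \<open>k = L\<close> reads \<open>s < Suc M - L\<close>, and
        \<open>M\<close> is the least value satisfying it.\<close>
      define s where "s = real \<Lambda> * real ((L + n) * (q - 1)) / \<tau>"
      define M where "M = L + nat \<lfloor>s\<rfloor>"
      let ?J = "X \<times> (exponents_less (Suc L) :: ('n \<Rightarrow> nat) set)"
      let ?p = "\<lambda>(a :: 'a ^ 'n, r) i. jet_basis (a $ i) (r i)"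
      have s0: "s \<ge> 0" using assms(2) by (simp add: s_def)
      have s: "s < real (Suc M - L)" "real M \<le> real L + s"
        using s0 by (simp_all add: M_def Suc_diff_le) linarith+
      define D where "D = L * q + n * (q - 1)"
      have D: "(\<Sum>i\<in>UNIV. degree (?p j i)) \<le> D" if "j \<in> ?J" for j
      proof -
        obtain a r where j: "j = (a, r)" by (cases j)
        have "(\<Sum>i\<in>UNIV. degree (?p j i)) = sum r UNIV * q + n * (q - 1)"
          by (simp only: j prod.case degree_jet_basis sum.distrib sum_distrib_right sum_constant of_nat_id q_def n_def)
        also have "\<dots> \<le> D"
          using that j by (auto simp: D_def exponents_less_def)
        finally show ?thesis .
      qed
      \<comment> \<open>Only \<open>k = L\<close> is critical: a smaller \<open>k\<close> adds
        \<open>\<Lambda> * (L - k)\<close> on the left and \<open>\<tau> * (L - k)\<close> on the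
        right, and \<open>\<Lambda> \<le> \<tau>\<close> in this case.\<close>
      have less: "real (\<Lambda> * (D - k)) < \<tau> * real (Suc M - k)" if "k \<le> L" for k
      proof -
        have eq: "D - k = (L + n) * (q - 1) + (L - k)"
        proof -
          obtain e where "q = Suc e" using q by (cases q) auto
          with that show ?thesis by (simp add: D_def add_mult_distrib)
        qed
        have "real (\<Lambda> * (D - k)) = real \<Lambda> * real ((L + n) * (q - 1)) + real \<Lambda> * real (L - k)"
          by (simp only: eq of_nat_mult of_nat_add distrib_left)
        also have "real \<Lambda> * real ((L + n) * (q - 1)) = \<tau> * s"
          using assms(2) by (simp add: s_def)
        also have "\<tau> * s + real \<Lambda> * real (L - k)
            < \<tau> * real (Suc M - L) + \<tau> * real (L - k)"
          using False s(1) assms(2) by (intro add_less_le_mono mult_strict_left_mono mult_right_mono) auto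
        also have "\<dots> = \<tau> * real (Suc M - k)"
          using that by (simp add: M_def flip: distrib_left of_nat_add)
        finally show ?thesis .
      qed
      have "card X * card (exponents_less (Suc L) :: ('n \<Rightarrow> nat) set)
          \<le> card Y * card (exponents_less (Suc M) :: ('n \<Rightarrow> nat) set)"
      proof (rule card_mult_exponents_le, intro ballI)
        fix c x and \<alpha> :: "'n \<Rightarrow> nat"
        assume van: "\<forall>y\<in>Y. \<forall>\<beta>\<in>exponents_less (Suc M). hasse_at ?J c ?p \<beta> y = 0"
          and x: "x \<in> X" and "\<alpha> \<in> exponents_less (Suc L)"
        then have \<alpha>: "sum \<alpha> UNIV \<le> L" by (simp add: exponents_less_def)
        obtain S where S: "curve_of_degree_le \<Lambda> S" "x \<in> S" "\<tau> \<le> real (card (S \<inter> Y))"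
          using assms(3)[OF x] by blast
        show "hasse_at ?J c ?p \<alpha> x = 0"
        proof (rule hasse_at_eq_0_transfer[OF _ D _ S _ less[OF \<alpha>]])
          show "finite ?J" by (simp add: finite_exponents_less)
          show "sum \<alpha> UNIV < Suc M" using \<alpha> by (simp add: M_def)
        qed (use van in \<open>auto simp: exponents_less_def\<close>)
      qed
      then have le: "card X * ((L + n) choose n) \<le> card Y * ((M + n) choose n)"
        by (simp add: card_exponents_less n_def)
      have "card X * Suc L ^ n \<le> card X * (fact n * ((L + n) choose n))"
        by (intro mult_left_mono power_le_fact_mult_binomial) simp
      also have "\<dots> \<le> card Y * (((M + n) choose n) * fact n)"
        using mult_right_mono[OF le, of "fact n"] by (simp add: mult_ac)
      also have "\<dots> \<le> card Y * (M + n) ^ n"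
        by (intro mult_left_mono binomial_fact_pow) simp
      finally have "real (card X * Suc L ^ n) \<le> real (card Y * (M + n) ^ n)"
        by (rule of_nat_mono)
      also have "\<dots> = real (card Y) * (real M + real n) ^ n" by simp
      also have "\<dots> \<le> real (card Y) * (\<rho> * (real L + 2 * real n)) ^ n"
      proof (intro mult_left_mono power_mono)
        \<comment> \<open>Hence \<open>M / L\<close> is asymptotically at most
          \<open>\<rho>\<close>, the base in the claim.\<close>
        have "s = (\<rho> - 1) * (real L + real n)"
          using q by (simp add: s_def \<rho>_def of_nat_diff)
        then have "real M + real n \<le> \<rho> * (real L + real n) + 1 * real n"
          using s(2) by (simp add: algebra_simps)
        also have "\<dots> \<le> \<rho> * (real L + real n) + \<rho> * real n"
          using \<rho> by (intro add_left_mono mult_right_mono) auto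
        finally show "real M + real n \<le> \<rho> * (real L + 2 * real n)"
          by (simp add: algebra_simps)
      qed auto
      finally show ?thesis by simp
    qed
    \<comment> \<open>This is \<open>(L + 2 * n) / (L + 1)\<close>, written so that its limit 1 is
      visible.\<close>
    define g where "g L = 1 + (2 * real n - 1) * inverse (real (Suc L))" for L
    have "g \<longlonglongrightarrow> 1 + (2 * real n - 1) * 0"
      unfolding g_def by (intro tendsto_intros LIMSEQ_inverse_real_of_nat)
    then have "(\<lambda>L. real (card Y) * (\<rho> * g L) ^ n) \<longlonglongrightarrow> real (card Y) * (\<rho> * 1) ^ n"
      by (intro tendsto_intros) simp
    moreover have "real (card X) \<le> real (card Y) * (\<rho> * g L) ^ n" for L
    proof -
      have "real L + 2 * real n = g L * real (Suc L)"
        by (simp add: g_def field_simps)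
      with main[of L] have "real (card X) * real (Suc L) ^ n
          \<le> (real (card Y) * (\<rho> * g L) ^ n) * real (Suc L) ^ n"
        by (simp only: power_mult_distrib mult.assoc)
      then show ?thesis by (rule mult_right_le_imp_le) simp
    qed
    ultimately have "real (card X) \<le> real (card Y) * (\<rho> * 1) ^ n"
      by (intro LIMSEQ_le_const) auto
    then show ?thesis by (simp add: mult.commute)
  qed
  then show ?thesis by (simp add: \<rho>_def q_def n_def)
qed

end
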